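(* Let $h$ be a real-valued summary of datasets with sensitivity $\Delta=\sup_{D\sim D'}|h(D)-h(D')|$. Let $\theta>0$ and let $\sigma>0$ satisfy $\sigma\ge\Delta/\theta$. Then the Laplace mechanism $$f_D(x)=\frac{1}{2\sigma}\exp\left\{-\frac{|x-h(D)|}{\sigma}\right\},\qquad x\in\mathbb{R},$$ satisfies $\theta$-Rao differential privacy, i.e. $d_R(f_D,f_{D'})\le\theta$ for all adjacent datasets $D\sim D'$, where $d_R$ is the Rao distance in the family of Laplace densities with fixed scale $\sigma$.
   Context: Datasets: $D=\{x_1,\dots,x_n\}$ with $x_i\in\mathcal{X}$ and $n$ fixed. Two datasets $D,D'$ are adjacent, written $D\sim D'$, if $|D|=|D'|$ and they differ in exactly one observation. Rao distance: for fixed $\sigma>0$ consider the one-parameter family $\{p(\cdot;\mu):\mu\in\mathbb{R}\}$, $p(x;\mu)=\frac{1}{2\sigma}\exp\{-|x-\mu|/\sigma\}$. Its Fisher information is $g(\mu)=\mathbb{E}_{x\sim p(\cdot;\mu)}\big[(\partial_\mu\ln p(x;\mu))^2\big]$ (the derivative exists almost everywhere), regarded as a Riemannian metric on the parameter space $\mathbb{R}$. The Rao distance $d_R(p(\cdot;\mu_1),p(\cdot;\mu_2))$ is the Riemannian distance between $\mu_1$ and $\mu_2$, i.e. the infimum of $\int_0^1\sqrt{g(\alpha(t))}\,|\dot\alpha(t)|\,dt$ over smooth paths $\alpha:[0,1]\to\mathbb{R}$ with $\alpha(0)=\mu_1$, $\alpha(1)=\mu_2$. Rao differential privacy: a mechanism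 $f_D$ satisfies $\theta$-Rao differential privacy if $d_R(f_D,f_{D'})\le\theta$ for all $D\sim D'$. *)

theory Defs
  imports "HOL-Probability.Probability"
begin

text \<open>Datasets are tuples \<open>(x\<^sub>1, \<dots>, x\<^sub>n)\<close> of observations in \<open>X\<close>, so that
  repeated observations are allowed. Summaries and mechanisms are arbitrary functions of
  the tuple; the ones depending only on the underlying multiset are a special case.\<close>

definition datasets :: "'x set \<Rightarrow> nat \<Rightarrow> 'x list set" where
  "datasets X n = {D. set D \<subseteq> X \<and> length D = n}"

definition adjacent :: "'x set \<Rightarrow> nat \<Rightarrow> 'x list \<Rightarrow> 'x list \<Rightarrow> bool" where
  "adjacent X n D D' \<longleftrightarrow>
     D \<in> datasets X n \<and> D' \<in> datasets X n \<and> card {i. i < n \<and> D ! i \<noteq> D' ! i} = 1"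

text \<open>The supremum is taken in \<open>[0, \<infinity>]\<close>: it is \<open>\<infinity>\<close> when the differences are unbounded.\<close>

definition sensitivity :: "'x set \<Rightarrow> nat \<Rightarrow> ('x list \<Rightarrow> real) \<Rightarrow> ennreal" where
  "sensitivity X n h =
     (SUP (D, D') \<in> {(D, D'). adjacent X n D D'}. ennreal \<bar>h D - h D'\<bar>)"

text \<open>A one-parameter family of densities is written \<open>p \<mu> x\<close> for \<open>p(x; \<mu>)\<close>.
  At points \<open>x\<close> where the \<open>\<mu>\<close>-derivative does not exist, \<^const>\<open>deriv\<close> has an unspecified
  value; this does not affect the integral when these points form a null set.\<close>

definition fisher_information :: "(real \<Rightarrow> real \<Rightarrow> real) \<Rightarrow> real \<Rightarrow> real" where
  "fisher_information p \<mu> =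
     (\<integral>x. (deriv (\<lambda>m. ln (p m x)) \<mu>)\<^sup>2 \<partial>density lborel (\<lambda>x. ennreal (p \<mu> x)))"

text \<open>Infinitely differentiable on \<open>[0, 1]\<close>, with one-sided derivatives at the endpoints;
  \<open>d k\<close> is the \<open>k\<close>-th derivative.\<close>

definition smooth_path :: "(real \<Rightarrow> real) \<Rightarrow> bool" where
  "smooth_path \<alpha> \<longleftrightarrow>
     (\<exists>d :: nat \<Rightarrow> real \<Rightarrow> real. d 0 = \<alpha> \<and>
        (\<forall>k. \<forall>t\<in>{0..1}. (d k has_vector_derivative d (Suc k) t) (at t within {0..1})))"

definition riemannian_length :: "(real \<Rightarrow> real) \<Rightarrow> (real \<Rightarrow> real) \<Rightarrow> ennreal" where
  "riemannian_length g \<alpha> =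
     (\<integral>\<^sup>+t\<in>{0..1}. ennreal (sqrt (g (\<alpha> t)) * \<bar>vector_derivative \<alpha> (at t within {0..1})\<bar>) \<partial>lborel)"

definition riemannian_dist :: "(real \<Rightarrow> real) \<Rightarrow> real \<Rightarrow> real \<Rightarrow> ennreal" where
  "riemannian_dist g \<mu>\<^sub>1 \<mu>\<^sub>2 =
     (INF \<alpha> \<in> {\<alpha>. smooth_path \<alpha> \<and> \<alpha> 0 = \<mu>\<^sub>1 \<and> \<alpha> 1 = \<mu>\<^sub>2}. riemannian_length g \<alpha>)"

text \<open>The Rao distance is a distance between densities. For an identifiable family the
  infimum ranges over at most one pair of parameters (see \<open>rao_dist_eq\<close> below); it is
  \<open>\<infinity>\<close> if one of the densities does not belong to the family.\<close>

definition rao_dist :: "(real \<Rightarrow> real \<Rightarrow> real) \<Rightarrow> (real \<Rightarrow> real) \<Rightarrow> (real \<Rightarrow> real) \<Rightarrow> ennreal" where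
  "rao_dist p f\<^sub>1 f\<^sub>2 =
     (INF (\<mu>\<^sub>1, \<mu>\<^sub>2) \<in> {(\<mu>\<^sub>1, \<mu>\<^sub>2). p \<mu>\<^sub>1 = f\<^sub>1 \<and> p \<mu>\<^sub>2 = f\<^sub>2}.
        riemannian_dist (fisher_information p) \<mu>\<^sub>1 \<mu>\<^sub>2)"

lemma rao_dist_eq:
  assumes "inj p"
  shows "rao_dist p (p \<mu>\<^sub>1) (p \<mu>\<^sub>2) = riemannian_dist (fisher_information p) \<mu>\<^sub>1 \<mu>\<^sub>2"
proof -
  have "{(m\<^sub>1, m\<^sub>2). p m\<^sub>1 = p \<mu>\<^sub>1 \<and> p m\<^sub>2 = p \<mu>\<^sub>2} = {(\<mu>\<^sub>1, \<mu>\<^sub>2)}"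
    using assms by (auto dest: injD)
  then show ?thesis
    by (simp add: rao_dist_def)
qed

definition rao_private ::
  "(real \<Rightarrow> real \<Rightarrow> real) \<Rightarrow> 'x set \<Rightarrow> nat \<Rightarrow> ('x list \<Rightarrow> real \<Rightarrow> real) \<Rightarrow> real \<Rightarrow> bool" where
  "rao_private p X n f \<theta> \<longleftrightarrow>
     (\<forall>D D'. adjacent X n D D' \<longrightarrow> rao_dist p (f D) (f D') \<le> ennreal \<theta>)"

definition laplace_density :: "real \<Rightarrow> real \<Rightarrow> real \<Rightarrow> real" where
  "laplace_density \<sigma> \<mu> x = 1 / (2 * \<sigma>) * exp (- (\<bar>x - \<mu>\<bar> / \<sigma>))"

lemma inj_laplace_density:
  assumes "\<sigma> > 0"
  shows "inj (laplace_density \<sigma>)"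
proof (rule injI)
  fix \<mu> \<nu> assume "laplace_density \<sigma> \<mu> = laplace_density \<sigma> \<nu>"
  then have "laplace_density \<sigma> \<mu> \<mu> = laplace_density \<sigma> \<nu> \<mu>"
    by simp
  then show "\<mu> = \<nu>"
    using assms by (simp add: laplace_density_def)
qed

end

theory Submission
  imports Defs
begin

text \<open>The score of the Laplace location family is \<open>\<plusminus> 1 / \<sigma>\<close> off the null set \<open>x = \<mu>\<close>, so its
  Fisher information is the constant \<open>1 / \<sigma>\<^sup>2\<close> and straight lines bound the Rao distance of
  the densities at \<open>\<mu>\<^sub>1\<close> and \<open>\<mu>\<^sub>2\<close> by \<open>\<bar>\<mu>\<^sub>1 - \<mu>\<^sub>2\<bar> / \<sigma>\<close>.\<close>

lemma borel_measurable_laplace_density [measurable]: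
  "laplace_density \<sigma> \<mu> \<in> borel_measurable borel"
  unfolding laplace_density_def by measurable

lemma nn_integral_exponential_density:
  assumes "0 < l"
  shows "(\<integral>\<^sup>+x. ennreal (exponential_density l x) \<partial>lborel) = 1"
proof -
  interpret prob_space "density lborel (exponential_density l)"
    using assms by (rule prob_space_exponential_density)
  show ?thesis
    using emeasure_space_1 by (simp add: emeasure_density)
qed

text \<open>The Laplace density is the equal mixture of an exponential density of rate
  \<open>1 / \<sigma>\<close> shifted to start at \<mu> and its mirror image about \<mu>, each of
  total mass one.\<close>

lemma nn_integral_laplace_density:
  assumes "\<sigma> > 0"
  shows "(\<integral>\<^sup>+x. ennreal (laplace_density \<sigma> \<mu> x) \<partial>lborel) = 1"
proof -
  let ?E = "\<lambda>x. ennreal (exponential_density (1 / \<sigma>) x)"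
  have right: "(\<integral>\<^sup>+x. ?E (- \<mu> + 1 * x) \<partial>lborel) = 1"
    using nn_integral_real_affine[of ?E 1 "- \<mu>"] nn_integral_exponential_density[of "1 / \<sigma>"] assms
    by simp
  have left: "(\<integral>\<^sup>+x. ?E (\<mu> + (- 1) * x) \<partial>lborel) = 1"
    using nn_integral_real_affine[of ?E "- 1" \<mu>] nn_integral_exponential_density[of "1 / \<sigma>"] assms
    by simp
  \<comment> \<open>The identity fails at the single point \<mu>: both exponential densities are
    positive at 0, so the mixture there is twice the Laplace density.\<close>
  have "AE x in lborel. ennreal (laplace_density \<sigma> \<mu> x) =
      ennreal (1 / 2) * ?E (- \<mu> + 1 * x) + ennreal (1 / 2) * ?E (\<mu> + (- 1) * x)"
    using AE_lborel_singleton[of \<mu>]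
  proof eventually_elim
    case (elim x)
    have "laplace_density \<sigma> \<mu> x = 1 / 2 * exponential_density (1 / \<sigma>) (- \<mu> + 1 * x)
        + 1 / 2 * exponential_density (1 / \<sigma>) (\<mu> + (- 1) * x)"
      using elim by (auto simp: laplace_density_def exponential_density_def diff_divide_distrib)
    moreover have "0 \<le> exponential_density (1 / \<sigma>) y" for y
      using assms by (simp add: exponential_density_nonneg)
    ultimately show ?case
      by (simp only: ennreal_plus ennreal_mult mult_nonneg_nonneg zero_le_divide_1_iff zero_le_numeral)
  qed
  then have "(\<integral>\<^sup>+x. ennreal (laplace_density \<sigma> \<mu> x) \<partial>lborel) =
      (\<integral>\<^sup>+x. ennreal (1 / 2) * ?E (- \<mu> + 1 * x) + ennreal (1 / 2) * ?E (\<mu> + (- 1) * x) \<partial>lborel)"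
    by (rule nn_integral_cong_AE)
  also have "\<dots> = ennreal (1 / 2) + ennreal (1 / 2)"
    using left right by (subst nn_integral_add) (simp_all add: nn_integral_cmult)
  also have "\<dots> = ennreal (1 / 2 + 1 / 2)"
    by (rule ennreal_plus[symmetric]) simp_all
  also have "\<dots> = 1"
    by simp
  finally show ?thesis .
qed

lemma prob_space_laplace_density:
  assumes "\<sigma> > 0"
  shows "prob_space (density lborel (\<lambda>x. ennreal (laplace_density \<sigma> \<mu> x)))"
  using nn_integral_laplace_density[OF assms]
  by (intro prob_spaceI) (simp add: emeasure_density)

lemma DERIV_abs:
  fixes x :: real
  assumes "x \<noteq> 0"
  shows "(abs has_real_derivative sgn x) (at x)"
  using has_derivative_norm[OF assms]
  by (simp add: has_field_derivative_def real_norm_def[abs_def] mult_commute_abs)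

text \<open>The logarithm is a constant minus \<open>\<bar>x - m\<bar> / \<sigma>\<close>. Since m
  enters with a minus sign inside the absolute value, the two signs cancel.\<close>

lemma deriv_ln_laplace_density:
  assumes "\<sigma> > 0" and "x \<noteq> \<mu>"
  shows "deriv (\<lambda>m. ln (laplace_density \<sigma> m x)) \<mu> = sgn (x - \<mu>) / \<sigma>"
proof -
  have "(\<lambda>m. ln (laplace_density \<sigma> m x)) = (\<lambda>m. ln (1 / (2 * \<sigma>)) - \<bar>x - m\<bar> / \<sigma>)"
    using assms by (auto simp: laplace_density_def ln_mult ln_div)
  moreover have "((\<lambda>m. ln (1 / (2 * \<sigma>)) - \<bar>x - m\<bar> / \<sigma>) has_real_derivative sgn (x - \<mu>) / \<sigma>) (at \<mu>)"
    using assms by (auto intro!: derivative_eq_intros DERIV_chain2[OF DERIV_abs])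
  ultimately show ?thesis
    by (simp add: DERIV_imp_deriv)
qed

lemma fisher_information_laplace:
  assumes "\<sigma> > 0"
  shows "fisher_information (laplace_density \<sigma>) \<mu> = 1 / \<sigma>\<^sup>2"
proof -
  let ?M = "density lborel (\<lambda>x. ennreal (laplace_density \<sigma> \<mu> x))"
  interpret prob_space ?M
    using assms by (rule prob_space_laplace_density)
  have score: "(deriv (\<lambda>m. ln (laplace_density \<sigma> m x)) \<mu>)\<^sup>2 = 1 / \<sigma>\<^sup>2" if "x \<noteq> \<mu>" for x
    using that by (simp add: deriv_ln_laplace_density[OF assms] power_divide sgn_if)
  \<comment> \<open>At \<open>x = \<mu>\<close> the value of \<open>deriv\<close> is unspecified,
    but it is still one fixed number, so the squared score is a constant function altered at one
    point.\<close>
  have meas: "(\<lambda>x. (deriv (\<lambda>m. ln (laplace_density \<sigma> m x)) \<mu>)\<^sup>2) \<in> borel_measurable ?M"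
  proof -
    have "(\<lambda>x. (deriv (\<lambda>m. ln (laplace_density \<sigma> m x)) \<mu>)\<^sup>2) =
        (\<lambda>x. if x = \<mu> then (deriv (\<lambda>m. ln (laplace_density \<sigma> m \<mu>)) \<mu>)\<^sup>2 else 1 / \<sigma>\<^sup>2)"
      using score by auto
    then show ?thesis
      by simp
  qed
  \<comment> \<open>The point \<mu> is Lebesgue null, hence also null for \<open>?M\<close>, which
    has a Lebesgue density.\<close>
  have "AE x in ?M. (deriv (\<lambda>m. ln (laplace_density \<sigma> m x)) \<mu>)\<^sup>2 = 1 / \<sigma>\<^sup>2"
    using AE_lborel_singleton[of \<mu>] score by (auto simp: AE_density)
  then have "fisher_information (laplace_density \<sigma>) \<mu> = (\<integral>x. 1 / \<sigma>\<^sup>2 \<partial>?M)"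
    unfolding fisher_information_def using meas by (intro integral_cong_AE) auto
  also have "\<dots> = 1 / \<sigma>\<^sup>2"
    using prob_space by simp
  finally show ?thesis .
qed

lemma smooth_path_affine: "smooth_path (\<lambda>t. a + t * b)"
proof -
  define d :: "nat \<Rightarrow> real \<Rightarrow> real"
    where "d k t = (if k = 0 then a + t * b else if k = 1 then b else 0)" for k t
  have "(d k has_vector_derivative d (Suc k) t) (at t within {0..1})" for k t
    unfolding has_real_derivative_iff_has_vector_derivative[symmetric] d_def
    by (cases "k = 0"; cases "k = 1") (auto intro!: derivative_eq_intros)
  moreover have "d 0 = (\<lambda>t. a + t * b)"
    by (simp add: d_def fun_eq_iff)
  ultimately show ?thesis
    unfolding smooth_path_def by blast
qed

text \<open>The integrand is constant along the path, and the parameter interval has length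
  one.\<close>

lemma riemannian_length_affine_const:
  "riemannian_length (\<lambda>_. c) (\<lambda>t. a + t * b) = ennreal (sqrt c * \<bar>b\<bar>)"
proof -
  have velocity: "vector_derivative (\<lambda>t. a + t * b) (at t within {0..1}) = b" if "t \<in> {0..1}" for t
    using that by (intro vector_derivative_within_closed_interval)
      (auto simp: has_real_derivative_iff_has_vector_derivative[symmetric]
        intro!: derivative_eq_intros)
  have "riemannian_length (\<lambda>_. c) (\<lambda>t. a + t * b) =
      (\<integral>\<^sup>+t\<in>{0..1::real}. ennreal (sqrt c * \<bar>b\<bar>) \<partial>lborel)"
    unfolding riemannian_length_def
    by (rule nn_integral_cong) (simp add: velocity split: split_indicator)
  also have "\<dots> = ennreal (sqrt c * \<bar>b\<bar>)"
    by (subst nn_integral_cmult_indicator) simp_all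
  finally show ?thesis .
qed

text \<open>The straight segment from \<open>\<mu>\<^sub>1\<close> to \<open>\<mu>\<^sub>2\<close>
  is one of the paths over which the infimum is taken.\<close>

lemma riemannian_dist_const_le:
  "riemannian_dist (\<lambda>_. c) \<mu>\<^sub>1 \<mu>\<^sub>2 \<le> ennreal (sqrt c * \<bar>\<mu>\<^sub>1 - \<mu>\<^sub>2\<bar>)"
proof -
  have "riemannian_dist (\<lambda>_. c) \<mu>\<^sub>1 \<mu>\<^sub>2 \<le> riemannian_length (\<lambda>_. c) (\<lambda>t. \<mu>\<^sub>1 + t * (\<mu>\<^sub>2 - \<mu>\<^sub>1))"
    unfolding riemannian_dist_def by (intro INF_lower) (simp add: smooth_path_affine)
  then show ?thesis
    by (simp add: riemannian_length_affine_const abs_minus_commute)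
qed

text \<open>Injectivity of the family turns the distance between densities into one between
  parameters, and the constant metric contributes the factor
  \<open>sqrt (1 / \<sigma>\<^sup>2) = 1 / \<sigma>\<close>.\<close>

lemma rao_dist_laplace_le:
  assumes "\<sigma> > 0"
  shows "rao_dist (laplace_density \<sigma>) (laplace_density \<sigma> \<mu>\<^sub>1) (laplace_density \<sigma> \<mu>\<^sub>2)
    \<le> ennreal (\<bar>\<mu>\<^sub>1 - \<mu>\<^sub>2\<bar> / \<sigma>)"
proof -
  have "fisher_information (laplace_density \<sigma>) = (\<lambda>_. 1 / \<sigma>\<^sup>2)"
    using assms by (simp add: fun_eq_iff fisher_information_laplace)
  then show ?thesis
    using riemannian_dist_const_le[of "1 / \<sigma>\<^sup>2" \<mu>\<^sub>1 \<mu>\<^sub>2] assms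
    by (simp add: rao_dist_eq inj_laplace_density real_sqrt_divide)
qed

lemma abs_diff_le_sensitivity:
  assumes "adjacent X n D D'"
  shows "ennreal \<bar>h D - h D'\<bar> \<le> sensitivity X n h"
  unfolding sensitivity_def using assms by (intro SUP_upper2[of "(D, D')"]) auto

theorem theorem4p4:
  fixes X :: "'x set" and n :: nat and h :: "'x list \<Rightarrow> real" and \<theta> \<sigma> :: real
  assumes "\<theta> > 0" and "\<sigma> > 0"
    and "ennreal \<sigma> \<ge> sensitivity X n h / ennreal \<theta>"
  shows "rao_private (laplace_density \<sigma>) X n
           (\<lambda>D x. 1 / (2 * \<sigma>) * exp (- (\<bar>x - h D\<bar> / \<sigma>))) \<theta>"
proof -
  have "rao_dist (laplace_density \<sigma>) (laplace_density \<sigma> (h D)) (laplace_density \<sigma> (h D')) \<le> ennreal \<theta>"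
    if "adjacent X n D D'" for D D'
  proof -
    \<comment> \<open>The comparison with the sensitivity stays in \<open>ennreal\<close>, where the
      supremum lives, so no finiteness argument has to be made first.\<close>
    have "ennreal (\<bar>h D - h D'\<bar> / \<theta>) = ennreal \<bar>h D - h D'\<bar> / ennreal \<theta>"
      using assms by (simp add: divide_ennreal)
    also have "\<dots> \<le> sensitivity X n h / ennreal \<theta>"
      by (intro divide_right_mono_ennreal abs_diff_le_sensitivity that)
    also have "\<dots> \<le> ennreal \<sigma>"
      by (rule assms)
    \<comment> \<open>Both \<open>\<theta>\<close> and \<open>\<sigma>\<close> are positive, so they
      can trade places in the real inequality.\<close>
    finally have "\<bar>h D - h D'\<bar> / \<sigma> \<le> \<theta>"
      using assms by (simp add: field_simps)
    then show ?thesis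
      using rao_dist_laplace_le[OF assms(2), of "h D" "h D'"] by (meson ennreal_leI order_trans)
  qed
  then show ?thesis
    by (simp add: rao_private_def laplace_density_def[abs_def])
qed

end
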